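(* Let $p$ be a prime number, let $i,j\in\mathbb{Z}$, and let $C^{(p;i,j)}$ be the hyperelliptic curve over $\mathbb{Q}$ defined by \[y^2=x(x^2+2^ip^{j})(x^2+2^{i+1}p^{j}).\] Suppose that one of the following conditions holds: (1) $p\equiv 3 \pmod{16}$ and $(i,j)=(0,1)$; (2) $p\equiv 11 \pmod{16}$ and $(i,j)=(1,1)$; (3) $p\equiv 3 \pmod{8}$ and $(i,j)=(0,2)$; (4) $p\equiv -3 \pmod{8}$ and $(i,j)=(0,2)$. Then $C^{(p;i,j)}(\mathbb{Q})=\{(0,0),\infty\}$.
   Context: The curve is the genus-2 hyperelliptic curve given by the affine equation above (the right-hand side is a separable polynomial of degree 5), and $\infty$ denotes its unique point at infinity. *)

theory Defs
  imports Complex_Main "HOL-Computational_Algebra.Polynomial" "HOL-Number_Theory.Cong"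
begin

text \<open>
  Points of the smooth projective model of a hyperelliptic curve \<open>y\<^sup>2 = f(x)\<close> with
  \<open>f\<close> separable of odd degree: such a model has exactly one point that does not lie on
  the affine curve, written \<open>Infinity\<close>, and it is rational over the base field.
\<close>

datatype 'a curve_point = Infinity | Affine 'a 'a

definition hyperelliptic_points :: "'a::field poly \<Rightarrow> 'a curve_point set" where
  "hyperelliptic_points f = insert Infinity {Affine x y | x y. y\<^sup>2 = poly f x}"

definition C_poly :: "nat \<Rightarrow> int \<Rightarrow> int \<Rightarrow> rat poly" where
  "C_poly p i j =
     [:0, 1:] * [:2 powi i * of_nat p powi j, 0, 1:] * [:2 powi (i + 1) * of_nat p powi j, 0, 1:]"

definition C_rational_points :: "nat \<Rightarrow> int \<Rightarrow> int \<Rightarrow> rat curve_point set" where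
  "C_rational_points p i j = hyperelliptic_points (C_poly p i j)"

lemma poly_C_poly:
  "poly (C_poly p i j) x =
     x * (x\<^sup>2 + 2 powi i * of_nat p powi j) * (x\<^sup>2 + 2 powi (i + 1) * of_nat p powi j)"
  by (simp add: C_poly_def power2_eq_square algebra_simps)

text \<open>The hypotheses on \<open>f\<close> under which \<open>hyperelliptic_points\<close> is meaningful hold for \<open>C_poly\<close>.\<close>

lemma degree_C_poly: "degree (C_poly p i j) = 5"
  by (simp add: C_poly_def)

lemma separable_C_poly:
  assumes "p > 0"
  shows "coprime (C_poly p i j) (pderiv (C_poly p i j))"
proof -
  define c :: rat where "c = 2 powi i * of_nat p powi j"
  have c: "c \<noteq> 0"
    using assms by (simp add: c_def)
  have f: "C_poly p i j = [:0, 2 * c\<^sup>2, 0, 3 * c, 0, 1:]"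
    by (simp add: C_poly_def c_def power_int_add power2_eq_square algebra_simps)
  have bezout: "[:0, - 33 * c, 0, - 35:] * C_poly p i j
      + [:4 * c\<^sup>2, 0, 15 * c, 0, 7:] * pderiv (C_poly p i j) = [:8 * c ^ 4:]"
    by (simp add: f pderiv_pCons algebra_simps power2_eq_square power4_eq_xxxx)
  show ?thesis
  proof (rule coprimeI)
    fix d assume "d dvd C_poly p i j" and "d dvd pderiv (C_poly p i j)"
    then have "d dvd [:8 * c ^ 4:]"
      unfolding bezout[symmetric] by (intro dvd_add dvd_mult)
    moreover have "is_unit [:8 * c ^ 4:]"
      using c by (simp add: is_unit_pCons_iff)
    ultimately show "is_unit d"
      by (rule dvd_trans)
  qed
qed

end

theory Submission
  imports Defs "HOL-Computational_Algebra.Nth_Powers"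
begin

text \<open>
  Put \<open>c = 2\<^sup>i p\<^sup>j\<close>. A rational point with \<open>x \<noteq> 0\<close> has \<open>x = u / v > 0\<close> in lowest terms, where \<open>v = b\<^sup>2\<close> and
  \<open>u (u\<^sup>2 + c v\<^sup>2) (u\<^sup>2 + 2 c v\<^sup>2)\<close> is a square. The three factors share no primes other than \<open>2\<close> and
  \<open>p\<close>, so each of them is a square up to a divisor of \<open>2 p\<close>. Every resulting system of equations is
  either insoluble modulo \<open>8\<close> or reduces to \<open>z\<^sup>2 = x\<^sup>4 + G w\<^sup>4\<close> with \<open>G = 1\<close>, \<open>G = 4\<close> or \<open>G = 2 p\<^sup>k\<close>,
  \<open>p\<^sup>k \<equiv> 3 (mod 8)\<close>. Fermat's descent excludes the latter: \<open>w = 2 y\<close> is even, factoring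
  \<open>(z - x\<^sup>2) (z + x\<^sup>2)\<close> gives \<open>x\<^sup>2 = m\<^sup>4 - 4 G n\<^sup>4\<close> with \<open>m n = y\<close>, and factoring
  \<open>(m\<^sup>2 - x) (m\<^sup>2 + x)\<close> gives \<open>m\<^sup>2 = r\<^sup>4 + G s\<^sup>4\<close> with \<open>r s = n\<close>; the other ways of distributing the
  divisors of \<open>4 G\<close> and \<open>G\<close> over the factors fail modulo \<open>8\<close>. For \<open>c = p\<^sup>2\<close> one also meets three
  squares in arithmetic progression with difference \<open>q\<^sup>2\<close> or \<open>2 q\<^sup>2\<close>, which enter the same descent at
  its second step.
\<close>

section \<open>Residues of squares and fourth powers modulo \<open>8\<close>\<close>

lemma odd_square_mod_8: "odd x \<Longrightarrow> x\<^sup>2 mod 8 = 1" for x :: nat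
proof -
  assume "odd x"
  then have "x mod 8 = 1 \<or> x mod 8 = 3 \<or> x mod 8 = 5 \<or> x mod 8 = 7" by presburger
  then show ?thesis by (subst power_mod[symmetric]) auto
qed

lemma square_mod_8: "x\<^sup>2 mod 8 = 0 \<or> x\<^sup>2 mod 8 = 1 \<or> x\<^sup>2 mod 8 = 4" for x :: nat
proof -
  have "x mod 8 \<in> {0,1,2,3,4,5,6,7}" by (simp, presburger)
  then show ?thesis by (subst (1 2 3) power_mod[symmetric]) auto
qed

lemma fourth_power_mod_8: "x ^ 4 mod 8 = (if odd x then 1 else 0)" for x :: nat
proof -
  have "x mod 8 \<in> {0,1,2,3,4,5,6,7}" by (simp, presburger)
  moreover have "odd x \<longleftrightarrow> odd (x mod 8)" by presburger
  ultimately show ?thesis by (subst power_mod[symmetric]) auto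
qed

lemma mult_fourth_power_mod_8: "(P * x ^ 4) mod 8 = (if odd x then P mod 8 else 0)" for x :: nat
  by (subst mod_mult_right_eq[symmetric]) (simp add: fourth_power_mod_8)

text \<open>Turns an equation between biquadratic forms into a check of parities.\<close>

lemma add_mult_fourth_powers_mod_8:
  "(P * x ^ 4 + Q * y ^ 4) mod 8 =
     ((if odd x then P mod 8 else 0) + (if odd y then Q mod 8 else 0)) mod 8" for x :: nat
  by (subst mod_add_eq[symmetric]) (simp only: mult_fourth_power_mod_8)

lemma add_odd_square_mod_8:
  fixes x :: nat
  assumes "odd x"
  shows "(x\<^sup>2 + P * y ^ 4) mod 8 = (1 + (if odd y then P mod 8 else 0)) mod 8"
  by (subst mod_add_eq[symmetric])
     (simp only: mult_fourth_power_mod_8 odd_square_mod_8[OF assms])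

section \<open>Coprime factors of squares and fourth powers\<close>

lemma coprime_add_multiple: "coprime a b \<Longrightarrow> a dvd c \<Longrightarrow> coprime a (b + c)" for a b c :: nat
  by (metis coprime_iff_gcd_eq_1 dvd_def gcd_add_mult add.commute mult.commute)

lemma coprime_mult_eq_power:
  fixes x y z :: nat
  assumes "coprime x y" "x * y = z ^ n" "n > 0"
  obtains a b where "x = a ^ n" "y = b ^ n"
proof -
  have "is_nth_power n (x * y)" using assms(2) by (auto simp: is_nth_power_def)
  then show ?thesis
    using is_nth_power_mult_coprime_nat_iff[OF assms(1), of n] assms(3) that
    by (auto simp: is_nth_power_def)
qed

text \<open>The gcd is \<open>1\<close> or \<open>q\<close>. In the second case \<open>q\<close> is
  taken out of both factors, leaving coprime factors whose product is again a square.\<close>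

lemma square_product_gcd_dvd_prime:
  fixes x y z q :: nat
  assumes xy: "x * y = z\<^sup>2" and g: "gcd x y dvd q" and q: "prime q" and "x > 0"
  obtains a b where "x = a\<^sup>2" "y = b\<^sup>2" | a b where "x = q * a\<^sup>2" "y = q * b\<^sup>2"
proof (cases "coprime x y")
  case True
  then show ?thesis using coprime_mult_eq_power[OF True xy] that(1) by auto
next
  case False
  with g q have gq: "gcd x y = q" using prime_nat_iff by (metis coprime_iff_gcd_eq_1)
  then obtain x' y' where x': "x = q * x'" and y': "y = q * y'" by (metis dvdE gcd_dvd1 gcd_dvd2)
  have q0: "q > 0" using q by (simp add: prime_gt_0_nat)
  have cop: "coprime x' y'" using gq q0 by (simp add: x' y' gcd_mult_distrib_nat[symmetric] coprime_iff_gcd_eq_1)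
  have "q dvd z" using xy q x' by (metis dvd_mult2 dvd_triv_left prime_dvd_power)
  then obtain z' where "z = q * z'" ..
  with xy q0 have "x' * y' = z'\<^sup>2" by (simp add: x' y' power2_eq_square)
  then obtain a b where "x' = a\<^sup>2" "y' = b\<^sup>2" using coprime_mult_eq_power[OF cop, of z' 2] by auto
  then show ?thesis using that(2) x' y' by blast
qed

lemma prime_times_square:
  fixes q X s :: nat
  assumes "q * X = s\<^sup>2" "prime q"
  obtains t where "X = q * t\<^sup>2"
proof -
  have "q dvd s" using assms by (metis dvd_triv_left prime_dvd_power)
  then obtain t where "s = q * t" ..
  then show ?thesis using assms that by (auto simp: power2_eq_square prime_gt_0_nat)
qed

text \<open>A prime cannot divide both factors. This allows the coprime factorizations of
  \<open>4 * G\<close> and \<open>G\<close> to be listed one prime power at a time.\<close>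

lemma prime_power_dvd_coprime_factor:
  fixes e f q :: nat
  assumes "prime q" "coprime e f" "q ^ k dvd e * f"
  shows "q ^ k dvd e \<or> q ^ k dvd f"
proof (cases "q dvd e")
  case True
  then have "\<not> q dvd f" using assms by (meson coprime_common_divisor not_prime_unit)
  then have "coprime (q ^ k) f" using assms(1) by (simp add: prime_imp_coprime)
  then show ?thesis using assms(3) coprime_dvd_mult_left_iff by blast
next
  case False
  then have "coprime (q ^ k) e" using assms(1) by (simp add: prime_imp_coprime)
  then show ?thesis using assms(3) coprime_dvd_mult_right_iff by blast
qed

text \<open>With \<open>e = gcd \<alpha> E\<close> and \<open>f = gcd \<beta> E\<close>, coprimality
  gives \<open>e * f = E\<close>; the cofactors are then coprime with product
  \<open>y ^ 4\<close>.\<close>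

lemma coprime_factors_times_fourth_power:
  fixes \<alpha> \<beta> E y :: nat
  assumes "coprime \<alpha> \<beta>" "\<alpha> * \<beta> = E * y ^ 4" "E > 0"
  obtains e f m n where "e * f = E" "m * n = y" "\<alpha> = e * m ^ 4" "\<beta> = f * n ^ 4"
proof -
  define e f where "e = gcd \<alpha> E" and "f = gcd \<beta> E"
  have cef: "coprime e f" using assms(1) by (simp add: e_def f_def coprime_divisors[of _ \<alpha> _ \<beta>])
  have "e * f dvd E" using cef by (intro divides_mult) (simp_all add: e_def f_def)
  moreover have "E dvd e * f"
  proof -
    have "E dvd \<alpha> * \<beta>" using assms(2) by simp
    then obtain a b where ab: "E = a * b" "a dvd \<alpha>" "b dvd \<beta>" using division_decomp by blast
    then show ?thesis unfolding e_def f_def by (simp add: mult_dvd_mono)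
  qed
  ultimately have ef: "e * f = E" by (simp add: dvd_antisym)
  obtain a b where ab: "\<alpha> = e * a" "\<beta> = f * b" by (metis dvdE e_def f_def gcd_dvd1)
  have "a * b = y ^ 4" using assms(2,3) ef ab by auto
  moreover have "coprime a b" using assms(1) ab by simp
  ultimately obtain m n where mn: "a = m ^ 4" "b = n ^ 4" by (metis coprime_mult_eq_power zero_less_numeral)
  with \<open>a * b = y ^ 4\<close> have "m * n = y"
    by (metis power_mult_distrib power_eq_iff_eq_base zero_le zero_less_numeral)
  then show ?thesis using that ef ab mn by blast
qed

section \<open>The two steps of Fermat's descent\<close>

text \<open>As \<open>x\<close> and \<open>z\<close> are odd,
  \<open>z - x\<^sup>2 = 2 * \<alpha>\<close> and
  \<open>\<alpha> * (\<alpha> + x\<^sup>2) = 4 * G * y ^ 4\<close>. The factors are coprime because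
  \<open>\<alpha>\<close> divides a number prime to \<open>x\<close>; their difference gives the new
  equation. The \<open>16\<close> stems from \<open>w = 2 * y\<close>.\<close>

lemma descent_step_sum:
  fixes x y z G :: nat
  assumes eq: "z\<^sup>2 = x ^ 4 + 16 * G * y ^ 4" and "odd x" and cop: "coprime x (G * y)" and "G > 0"
  obtains e f m n where "e * f = 4 * G" "m * n = y" "x\<^sup>2 + f * n ^ 4 = e * m ^ 4"
    "coprime (e * m) (f * n)"
proof -
  have "(x\<^sup>2)\<^sup>2 \<le> z\<^sup>2" using eq by simp
  then have le: "x\<^sup>2 \<le> z" by (simp only: power2_nat_le_eq_le)
  have "odd (z\<^sup>2)" unfolding eq using \<open>odd x\<close> by simp
  then have "even (z - x\<^sup>2)" using \<open>odd x\<close> by simp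
  then obtain \<alpha> where \<alpha>: "z = x\<^sup>2 + 2 * \<alpha>" using le by (metis dvdE le_add_diff_inverse)
  have prod: "(\<alpha> + x\<^sup>2) * \<alpha> = 4 * G * y ^ 4"
    using eq unfolding \<alpha> by (simp add: power2_eq_square power4_eq_xxxx algebra_simps)
  have "coprime x (2 * 2)" unfolding coprime_mult_right_iff using \<open>odd x\<close> by simp
  then have "coprime x (4 * G * y ^ 4)" using cop by simp
  then have "coprime x \<alpha>" by (metis coprime_divisors dvd_refl dvd_triv_right prod)
  then have "coprime \<alpha> (x\<^sup>2 + \<alpha>)" by (intro coprime_add_multiple) (simp_all add: coprime_commute)
  then have "coprime (\<alpha> + x\<^sup>2) \<alpha>" by (simp add: ac_simps)
  then obtain e f m n where *: "e * f = 4 * G" "m * n = y" "\<alpha> + x\<^sup>2 = e * m ^ 4" "\<alpha> = f * n ^ 4"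
    using coprime_factors_times_fourth_power[OF _ prod] \<open>G > 0\<close>
    by (metis mult_pos_pos zero_less_numeral)
  moreover have "coprime (e * m) (f * n)"
    using \<open>coprime (\<alpha> + x\<^sup>2) \<alpha>\<close> * by simp
  ultimately show ?thesis using that by (metis add.commute)
qed

text \<open>Here \<open>m\<^sup>2 - X = 2 * \<alpha>\<close> and
  \<open>\<alpha> * (\<alpha> + X) = G * n ^ 4\<close>. A common divisor of these factors divides
  their sum \<open>m\<^sup>2\<close> and their product, which are coprime; the sum gives the new
  equation.\<close>

lemma descent_step_difference:
  fixes X n m G :: nat
  assumes eq: "X\<^sup>2 + 4 * G * n ^ 4 = m ^ 4" and "odd X" and cop: "coprime m (G * n)" and "G > 0"
  obtains g h r s where "g * h = G" "r * s = n" "m\<^sup>2 = g * r ^ 4 + h * s ^ 4"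
    "coprime (g * r) (h * s)" "odd m"
proof -
  have "X\<^sup>2 \<le> (m\<^sup>2)\<^sup>2" using eq by simp
  then have le: "X \<le> m\<^sup>2" by (simp only: power2_nat_le_eq_le)
  have "odd (m ^ 4)" unfolding eq[symmetric] using \<open>odd X\<close> by simp
  then have om: "odd m" by simp
  then have "even (m\<^sup>2 - X)" using \<open>odd X\<close> by simp
  then obtain \<alpha> where \<alpha>: "m\<^sup>2 = X + 2 * \<alpha>" using le by (metis dvdE le_add_diff_inverse)
  have "(m\<^sup>2)\<^sup>2 = X\<^sup>2 + 4 * G * n ^ 4" using eq by simp
  then have prod: "(\<alpha> + X) * \<alpha> = G * n ^ 4"
    unfolding \<alpha> by (simp add: power2_eq_square power4_eq_xxxx algebra_simps)
  have c1: "coprime (m\<^sup>2) (G * n ^ 4)" using cop by simp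
  have c2: "coprime (\<alpha> + X) \<alpha>"
  proof (rule coprimeI)
    fix d assume d: "d dvd \<alpha> + X" "d dvd \<alpha>"
    then have "d dvd (\<alpha> + X) + \<alpha>" by (rule dvd_add)
    then have "d dvd m\<^sup>2" by (simp add: \<alpha> mult_2 add.assoc add.left_commute)
    moreover have "d dvd G * n ^ 4" using d prod by (metis dvd_mult)
    ultimately show "is_unit d" using c1 by (meson coprime_common_divisor)
  qed
  then obtain e f r s where *: "e * f = G" "r * s = n" "\<alpha> + X = e * r ^ 4" "\<alpha> = f * s ^ 4"
    using coprime_factors_times_fourth_power[OF _ prod] \<open>G > 0\<close> by metis
  moreover have "coprime (e * r) (f * s)" using c2 * by simp
  moreover have "m\<^sup>2 = e * r ^ 4 + f * s ^ 4" using \<alpha> * by simp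
  ultimately show ?thesis using that om by metis
qed

section \<open>The equation \<open>z\<^sup>2 = x ^ 4 + G * w ^ 4\<close>\<close>

text \<open>Coefficients for which congruences modulo \<open>8\<close> exclude the unwanted
  splittings in the descent. \<open>1\<close> and \<open>4\<close> serve
  \<open>c = p\<^sup>2\<close>; the power \<open>p ^ k\<close> covers \<open>p\<close> and
  \<open>p ^ 3\<close>, which both arise from \<open>c = p\<close> and
  \<open>c = 2 * p\<close>.\<close>

definition descent_coefficient :: "nat \<Rightarrow> bool" where
  "descent_coefficient G \<longleftrightarrow>
     G = 1 \<or> G = 4 \<or> (\<exists>p k. G = 2 * p ^ k \<and> prime p \<and> p ^ k mod 8 = 3)"

lemma descent_coefficient_pos: "descent_coefficient G \<Longrightarrow> G > 0"
  by (auto simp: descent_coefficient_def prime_gt_0_nat)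

text \<open>The full power of \<open>2\<close>, and likewise \<open>p ^ k\<close>, goes to one of
  \<open>e\<close> and \<open>f\<close>. If \<open>2\<close> goes to \<open>e\<close>, then modulo
  \<open>8\<close> the left side is \<open>1\<close> or \<open>2\<close> (or \<open>4\<close> when
  \<open>f = p ^ k\<close>), but the right side is \<open>0\<close> (or possibly \<open>4\<close>
  when \<open>e = 4\<close>, \<open>f = 1\<close>). If \<open>e = p ^ k\<close>, the left side is
  \<open>1\<close> and the right side \<open>0\<close> or \<open>3\<close>.\<close>

lemma coprime_split_difference:
  fixes e f x m n G :: nat
  assumes G: "descent_coefficient G" and ef: "e * f = 4 * G" "coprime e f"
    and eq: "x\<^sup>2 + f * n ^ 4 = e * m ^ 4" and "odd x"
  shows "e = 1"
proof -
  have mod_eq: "(1 + (if odd n then f mod 8 else 0)) mod 8 = (if odd m then e mod 8 else 0)"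
    using eq add_odd_square_mod_8[OF \<open>odd x\<close>, of f n] mult_fourth_power_mod_8[of e m] by simp
  have two: "prime (2::nat)" by simp
  from G consider "G = 1" | "G = 4" | p k where "G = 2 * p ^ k" "prime p" "p ^ k mod 8 = 3"
    by (auto simp: descent_coefficient_def)
  then show ?thesis
  proof cases
    case 1
    then have "2 ^ 2 dvd e \<or> 2 ^ 2 dvd f"
      using prime_power_dvd_coprime_factor[OF two ef(2), of 2] ef(1) by simp
    then show ?thesis
    proof
      assume "2 ^ 2 dvd e"
      then obtain e' where e': "e = 4 * e'" by auto
      with ef 1 have "f = 1" "e = 4" by simp_all
      with mod_eq show ?thesis by (simp split: if_splits)
    next
      assume "2 ^ 2 dvd f"
      then obtain f' where "f = 4 * f'" by auto
      with ef 1 show ?thesis by simp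
    qed
  next
    case 2
    then have "2 ^ 4 dvd e \<or> 2 ^ 4 dvd f"
      using prime_power_dvd_coprime_factor[OF two ef(2), of 4] ef(1) by simp
    then show ?thesis
    proof
      assume "2 ^ 4 dvd e"
      then obtain e' where e': "e = 16 * e'" by auto
      with ef 2 have "f = 1" "e = 16" by simp_all
      with mod_eq show ?thesis by (simp split: if_splits)
    next
      assume "2 ^ 4 dvd f"
      then obtain f' where "f = 16 * f'" by auto
      with ef 2 show ?thesis by simp
    qed
  next
    case 3
    have "coprime (p ^ k) 2" using 3(3) by (simp only: coprime_right_2_iff_odd) presburger
    then have "coprime (p ^ k) (2 * 2 * 2)" unfolding coprime_mult_right_iff by simp
    then have cP: "coprime (p ^ k) 8" by simp
    have P0: "p ^ k > 0" using 3 by (simp add: prime_gt_0_nat)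
    have pk: "p ^ k dvd e \<or> p ^ k dvd f"
      using prime_power_dvd_coprime_factor[OF 3(2) ef(2), of k] ef(1) 3 by simp
    have "2 ^ 3 dvd e \<or> 2 ^ 3 dvd f"
      using prime_power_dvd_coprime_factor[OF two ef(2), of 3] ef(1) 3 by simp
    then show ?thesis
    proof
      assume "2 ^ 3 dvd e"
      then obtain e' where e': "e = 8 * e'" by auto
      with ef 3 have e'f: "e' * f = p ^ k" by simp
      have "f = 1 \<or> f = p ^ k"
      proof (cases "p ^ k dvd e")
        case True
        then have "p ^ k dvd e'" using cP by (simp add: e' coprime_dvd_mult_right_iff)
        then obtain l where "e' = p ^ k * l" ..
        with e'f P0 show ?thesis by auto
      next
        case False
        with pk obtain l where "f = p ^ k * l" by blast
        with e'f P0 show ?thesis by auto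
      qed
      then have "f mod 8 = 1 \<or> f mod 8 = 3" using 3(3) by auto
      with mod_eq e' show ?thesis by (elim disjE; cases "odd n"; cases "odd m") simp_all
    next
      assume "2 ^ 3 dvd f"
      then obtain f' where f': "f = 8 * f'" by auto
      with ef 3 have ef': "e * f' = p ^ k" by simp
      show ?thesis
      proof (cases "p ^ k dvd f")
        case True
        then have "p ^ k dvd f'" using cP by (simp add: f' coprime_dvd_mult_right_iff)
        then obtain l where "f' = p ^ k * l" ..
        with ef' P0 show ?thesis by auto
      next
        case False
        with pk obtain l where "e = p ^ k * l" by blast
        with ef' P0 have "e = p ^ k" by auto
        with mod_eq f' 3(3) show ?thesis by (auto split: if_splits)
      qed
    qed
  qed
qed

text \<open>For \<open>G = 1\<close> and \<open>G = 4\<close> coprimality alone leaves a factor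
  \<open>1\<close>. For \<open>G = 2 * p ^ k\<close> the other splitting is into \<open>2\<close>
  and \<open>p ^ k\<close>, and \<open>2 * a ^ 4 + p ^ k * b ^ 4\<close> is \<open>0\<close>,
  \<open>2\<close>, \<open>3\<close> or \<open>5\<close> modulo \<open>8\<close>, never an odd
  square.\<close>

lemma coprime_split_sum:
  fixes g h m r s G :: nat
  assumes G: "descent_coefficient G" and gh: "g * h = G" "coprime g h"
    and eq: "m\<^sup>2 = g * r ^ 4 + h * s ^ 4" and "odd m"
  shows "g = 1 \<or> h = 1"
proof -
  have m8: "m\<^sup>2 mod 8 = 1" using \<open>odd m\<close> by (rule odd_square_mod_8)
  have two: "prime (2::nat)" by simp
  from G consider "G = 1" | "G = 4" | p k where "G = 2 * p ^ k" "prime p" "p ^ k mod 8 = 3"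
    by (auto simp: descent_coefficient_def)
  then show ?thesis
  proof cases
    case 1
    with gh show ?thesis by simp
  next
    case 2
    then have "2 ^ 2 dvd g \<or> 2 ^ 2 dvd h"
      using prime_power_dvd_coprime_factor[OF two gh(2), of 2] gh(1) by simp
    with gh 2 show ?thesis by (auto simp: dvd_def)
  next
    case 3
    have P0: "p ^ k > 0" using 3 by (simp add: prime_gt_0_nat)
    have cP: "coprime (p ^ k) 2" using 3(3) by (simp only: coprime_right_2_iff_odd) presburger
    have bad: False if "(2 * a ^ 4 + p ^ k * b ^ 4) mod 8 = 1" for a b :: nat
      using that 3(3) unfolding add_mult_fourth_powers_mod_8 by (auto split: if_splits)
    have pk: "p ^ k dvd g \<or> p ^ k dvd h"
      using prime_power_dvd_coprime_factor[OF 3(2) gh(2), of k] gh(1) 3 by simp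
    have "2 ^ 1 dvd g \<or> 2 ^ 1 dvd h"
      using prime_power_dvd_coprime_factor[OF two gh(2), of 1] gh(1) 3 by simp
    then show ?thesis
    proof
      assume "2 ^ 1 dvd g"
      then obtain g' where g': "g = 2 * g'" by auto
      with gh 3 have g'h: "g' * h = p ^ k" by simp
      show ?thesis
      proof (cases "p ^ k dvd g")
        case True
        then have "p ^ k dvd g'" using cP by (simp add: g' coprime_dvd_mult_right_iff)
        then obtain l where "g' = p ^ k * l" ..
        with g'h P0 show ?thesis by auto
      next
        case False
        with pk obtain l where "h = p ^ k * l" by blast
        with g'h P0 have "h = p ^ k" "g = 2" by (auto simp: g')
        with eq m8 bad show ?thesis by metis
      qed
    next
      assume "2 ^ 1 dvd h"
      then obtain h' where h': "h = 2 * h'" by auto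
      with gh 3 have gh': "g * h' = p ^ k" by simp
      show ?thesis
      proof (cases "p ^ k dvd h")
        case True
        then have "p ^ k dvd h'" using cP by (simp add: h' coprime_dvd_mult_right_iff)
        then obtain l where "h' = p ^ k * l" ..
        with gh' P0 show ?thesis by auto
      next
        case False
        with pk obtain l where "g = p ^ k * l" by blast
        with gh' P0 have "g = p ^ k" "h = 2" by (auto simp: h')
        with eq m8 bad show ?thesis by (metis add.commute)
      qed
    qed
  qed
qed

text \<open>Prepares the descent, which starts from odd \<open>x\<close> and even \<open>w\<close>.
  If both were odd, \<open>z\<^sup>2\<close> would be \<open>2\<close>, \<open>5\<close> or
  \<open>7\<close> modulo \<open>8\<close>; an even \<open>x\<close> is coprime to
  \<open>G * w\<close> only for \<open>G = 1\<close>, where \<open>x\<close> and \<open>w\<close>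
  can be exchanged.\<close>

lemma fourth_power_sum_parity:
  fixes x z w G :: nat
  assumes G: "descent_coefficient G" and eq: "z\<^sup>2 = x ^ 4 + G * w ^ 4" and cop: "coprime x (G * w)"
  shows "odd x \<and> even w \<or> G = 1 \<and> even x \<and> odd w"
proof -
  have mod_eq: "z\<^sup>2 mod 8 = ((if odd x then 1 else 0) + (if odd w then G mod 8 else 0)) mod 8"
    using add_mult_fourth_powers_mod_8[of 1 x G w] eq by simp
  from G consider "G = 1" | "G = 4" | P where "G = 2 * P" "P mod 8 = 3"
    by (auto simp: descent_coefficient_def)
  then show ?thesis
  proof cases
    case 1
    have "\<not> (even x \<and> even w)" using cop by (auto dest: coprime_common_divisor)
    moreover have "\<not> (odd x \<and> odd w)"
      using mod_eq 1 square_mod_8[of z] by (cases "odd x"; cases "odd w") simp_all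
    ultimately show ?thesis using 1 by blast
  next
    case 2
    with cop have "odd x" by (auto dest: coprime_common_divisor[of _ _ 2])
    moreover have "even w" if "odd x"
      using mod_eq 2 square_mod_8[of z] that by (auto split: if_splits)
    ultimately show ?thesis by blast
  next
    case 3
    then have "G mod 8 = 6" by presburger
    moreover have "odd x" using cop 3 by (auto dest: coprime_common_divisor[of _ _ 2])
    ultimately have "even w"
      using mod_eq square_mod_8[of z] by (auto split: if_splits)
    with \<open>odd x\<close> show ?thesis by blast
  qed
qed

text \<open>Infinite descent on \<open>x * w\<close>: both steps together lead to a solution made of
  \<open>r\<close> and \<open>s\<close> with \<open>r * s = n \<le> y < w'\<close>.\<close>

lemma no_fourth_power_sum:
  fixes x z w G :: nat
  assumes G: "descent_coefficient G"
  shows "z\<^sup>2 = x ^ 4 + G * w ^ 4 \<Longrightarrow> coprime x (G * w) \<Longrightarrow> x > 0 \<Longrightarrow> w > 0 \<Longrightarrow> False"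
proof (induction "x * w" arbitrary: x w z rule: less_induct)
  case less
  \<comment> \<open>Formulated for any pair with the same product, so that it also covers the
    exchanged pair when \<open>G = 1\<close>.\<close>
  have step: False if eq: "z\<^sup>2 = x' ^ 4 + G * w' ^ 4" and cop: "coprime x' (G * w')"
    and odd: "odd x'" and even: "even w'" and w0: "w' > 0" and xw: "x' * w' = x * w" for x' w' :: nat
  proof -
    have G0: "G > 0" using G by (rule descent_coefficient_pos)
    obtain y where y: "w' = 2 * y" using even by auto
    have eq': "z\<^sup>2 = x' ^ 4 + 16 * G * y ^ 4" using eq by (simp add: y power_mult_distrib)
    have cop': "coprime x' (G * y)" using cop by (simp add: y)
    obtain e f m n where 1: "e * f = 4 * G" "m * n = y" "x'\<^sup>2 + f * n ^ 4 = e * m ^ 4"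
      "coprime (e * m) (f * n)"
      using descent_step_sum[OF eq' odd cop' G0] by blast
    then have "coprime e f" by simp
    then have "e = 1" using coprime_split_difference[OF G 1(1) _ 1(3) odd] by blast
    with 1 have f: "f = 4 * G" by simp
    have cmn: "coprime m (G * n)" using 1(4) \<open>e = 1\<close> f by simp
    have eq2: "x'\<^sup>2 + 4 * G * n ^ 4 = m ^ 4" using 1(3) \<open>e = 1\<close> f by simp
    obtain g h r s where 2: "g * h = G" "r * s = n" "m\<^sup>2 = g * r ^ 4 + h * s ^ 4"
      "coprime (g * r) (h * s)" "odd m"
      using descent_step_difference[OF eq2 odd cmn G0] by blast
    have "coprime g h" using 2(4) by simp
    then have gh: "g = 1 \<or> h = 1" using coprime_split_sum[OF G 2(1) _ 2(3,5)] by blast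
    have n0: "m > 0" "n > 0" using 1(2) w0 y by auto
    then have rs: "r > 0" "s > 0" using 2(2) by auto
    have "x' > 0" using odd by (cases x') auto
    have "n \<le> y" using 1(2) n0 by auto
    also have "y < w'" using y w0 by simp
    also have "w' \<le> x' * w'" using \<open>x' > 0\<close> by simp
    finally have lt: "r * s < x * w" using 2(2) xw by simp
    from gh show False
    proof
      assume "g = 1"
      then show False using less.hyps[of r s m] lt 2 rs by simp
    next
      assume "h = 1"
      then show False using less.hyps[of s r m] lt 2 rs by (simp add: ac_simps coprime_commute)
    qed
  qed
  from fourth_power_sum_parity[OF G less.prems(1,2)] show False
  proof (elim disjE conjE)
    assume "odd x" "even w"
    then show False using step[of x w] less.prems by simp
  next
    assume "G = 1" "even x" "odd w"
    then show False using step[of w x] less.prems by (simp add: ac_simps coprime_commute)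
  qed
qed

section \<open>Three squares in arithmetic progression\<close>

lemma no_three_squares_difference_square:
  fixes x q m r :: nat
  assumes "x\<^sup>2 + q\<^sup>2 = m\<^sup>2" "x\<^sup>2 + 2 * q\<^sup>2 = r\<^sup>2" "coprime x q" "q > 0"
  shows False
proof -
  \<comment> \<open>For odd \<open>q\<close>, both \<open>x\<^sup>2 + 1\<close> and
    \<open>x\<^sup>2 + 2\<close> would be squares modulo \<open>8\<close>, which is
    impossible.\<close>
  have "odd x \<and> even q"
  proof (rule ccontr)
    assume "\<not> ?thesis"
    moreover have "\<not> (even x \<and> even q)" using assms(3) by (auto dest: coprime_common_divisor)
    ultimately have "odd q" by blast
    then have "q\<^sup>2 mod 8 = 1" by (rule odd_square_mod_8)
    then have "m\<^sup>2 mod 8 = (x\<^sup>2 mod 8 + 1) mod 8" "r\<^sup>2 mod 8 = (x\<^sup>2 mod 8 + 2) mod 8"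
      unfolding assms(1,2)[symmetric] by presburger+
    then show False using square_mod_8[of x] square_mod_8[of r] square_mod_8[of m] by (elim disjE) simp_all
  qed
  then obtain n where q: "q = 2 * n" and x: "odd x" by auto
  have r: "odd r"
  proof -
    have "odd (r\<^sup>2)" unfolding assms(2)[symmetric] using x by simp
    then show ?thesis by simp
  qed
  \<comment> \<open>the product of the outer two squares is \<open>(m\<^sup>2 - q\<^sup>2) (m\<^sup>2 + q\<^sup>2)\<close>\<close>
  have "(x * r)\<^sup>2 + q ^ 4 = m ^ 4"
  proof -
    have "m ^ 4 = (x\<^sup>2 + q\<^sup>2)\<^sup>2" using assms(1) by simp
    also have "\<dots> = x\<^sup>2 * (x\<^sup>2 + 2 * q\<^sup>2) + q ^ 4"
      by (simp add: power2_eq_square power4_eq_xxxx algebra_simps)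
    finally show ?thesis using assms(2) by (simp add: power_mult_distrib)
  qed
  then have eq: "(x * r)\<^sup>2 + 4 * 4 * n ^ 4 = m ^ 4" by (simp add: q power_mult_distrib)
  have cop2: "coprime (m\<^sup>2) q"
    unfolding assms(1)[symmetric] using assms(3) coprime_add_multiple[of q "x\<^sup>2" "q\<^sup>2"]
    by (simp add: coprime_commute)
  then have "coprime m (2 * (2 * n))" unfolding coprime_mult_right_iff by (simp add: q)
  then have cop: "coprime m (4 * n)" by simp
  have G: "descent_coefficient 4" by (simp add: descent_coefficient_def)
  obtain g h a b where *: "g * h = 4" "a * b = n" "m\<^sup>2 = g * a ^ 4 + h * b ^ 4"
    "coprime (g * a) (h * b)" "odd m"
    using descent_step_difference[OF eq _ cop] x r by (metis even_mult_iff zero_less_numeral)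
  have ab: "a > 0" "b > 0" using *(2) q assms(4) by auto
  have "g = 1 \<or> h = 1" using coprime_split_sum[OF G *(1) _ *(3,5)] *(4) by simp
  then show False
  proof
    assume "g = 1"
    then show False using no_fourth_power_sum[OF G, of m a b] * ab by simp
  next
    assume "h = 1"
    then show False using no_fourth_power_sum[OF G, of m b a] * ab by (simp add: ac_simps coprime_commute)
  qed
qed

text \<open>The outer squares multiply to
  \<open>(m\<^sup>2 - 2 * q\<^sup>2) * (m\<^sup>2 + 2 * q\<^sup>2)\<close>. This is the second
  descent step with \<open>G = 1\<close>, whose only splitting is \<open>g = h = 1\<close>.\<close>

lemma no_three_squares_difference_twice_square:
  fixes x q m r :: nat
  assumes "x\<^sup>2 + 2 * q\<^sup>2 = m\<^sup>2" "x\<^sup>2 + 4 * q\<^sup>2 = r\<^sup>2" "coprime x q" "odd x" "q > 0"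
  shows False
proof -
  have r: "odd r"
  proof -
    have "odd (r\<^sup>2)" unfolding assms(2)[symmetric] using \<open>odd x\<close> by simp
    then show ?thesis by simp
  qed
  have eq: "(x * r)\<^sup>2 + 4 * 1 * q ^ 4 = m ^ 4"
  proof -
    have "m ^ 4 = (x\<^sup>2 + 2 * q\<^sup>2)\<^sup>2" using assms(1) by simp
    also have "\<dots> = x\<^sup>2 * (x\<^sup>2 + 4 * q\<^sup>2) + 4 * q ^ 4"
      by (simp add: power2_eq_square power4_eq_xxxx algebra_simps)
    finally show ?thesis using assms(2) by (simp add: power_mult_distrib)
  qed
  have "coprime (x\<^sup>2 + 2 * q\<^sup>2) q"
    using assms(3) coprime_add_multiple[of q "x\<^sup>2" "2 * q\<^sup>2"]
    by (simp add: coprime_commute)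
  then have cop: "coprime m (1 * q)" unfolding assms(1) by simp
  have G: "descent_coefficient 1" by (simp add: descent_coefficient_def)
  obtain g h a b where *: "g * h = 1" "a * b = q" "m\<^sup>2 = g * a ^ 4 + h * b ^ 4"
    "coprime (g * a) (h * b)" "odd m"
    using descent_step_difference[OF eq _ cop] assms(4) r by (metis even_mult_iff zero_less_one)
  have ab: "a > 0" "b > 0" using *(2) assms(5) by auto
  show False using no_fourth_power_sum[OF G, of m a b] * ab by simp
qed

section \<open>Biquadratic equations with coefficients \<open>2\<close> and
  \<open>p ^ k\<close>\<close>

text \<open>That \<open>x\<close> is odd follows modulo \<open>8\<close>: an even \<open>x\<close>
  forces an odd \<open>w\<close>, and \<open>z\<^sup>2\<close> would be \<open>6\<close>.\<close>

lemma no_fourth_power_sum_twice_prime_power: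
  fixes x z w p k :: nat
  assumes p: "prime p" "p ^ k mod 8 = 3" and eq: "z\<^sup>2 = x ^ 4 + 2 * p ^ k * w ^ 4"
    and cop: "coprime x w" "coprime x p" and "x > 0" "w > 0"
  shows False
proof -
  have "(2 * p ^ k) mod 8 = 6" using p(2) by presburger
  then have "z\<^sup>2 mod 8 = ((if odd x then 1 else 0) + (if odd w then 6 else 0)) mod 8"
    using add_mult_fourth_powers_mod_8[of 1 x "2 * p ^ k" w] eq by simp
  moreover have "\<not> (even x \<and> even w)" using cop(1) by (auto dest: coprime_common_divisor)
  ultimately have "odd x" using square_mod_8[of z] by (auto split: if_splits)
  then have "coprime x (2 * p ^ k * w)" using cop by simp
  moreover have "descent_coefficient (2 * p ^ k)" using p by (auto simp: descent_coefficient_def)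
  ultimately show False using no_fourth_power_sum eq assms(6,7) by blast
qed

text \<open>As \<open>x\<close> and \<open>y\<close> are not both even, the right side is
  \<open>2\<close>, \<open>3\<close> or \<open>5\<close> modulo \<open>8\<close>.\<close>

lemma mult_fourth_power_add_twice_not_square:
  fixes P x y z :: nat
  assumes "P mod 8 = 3" "coprime x y"
  shows "z\<^sup>2 \<noteq> P * x ^ 4 + 2 * y ^ 4"
proof
  assume "z\<^sup>2 = P * x ^ 4 + 2 * y ^ 4"
  then have "z\<^sup>2 mod 8 = ((if odd x then 3 else 0) + (if odd y then 2 else 0)) mod 8"
    using add_mult_fourth_powers_mod_8[of P x 2 y] assms(1) by simp
  moreover have "\<not> (even x \<and> even y)" using assms(2) by (auto dest: coprime_common_divisor)
  ultimately show False using square_mod_8[of z] by (auto split: if_splits)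
qed

section \<open>Square values of \<open>k * (a + b) * (a + 2 * b)\<close>\<close>

lemma progression_coprime:
  fixes a b :: nat
  assumes "coprime a b"
  shows "coprime a (a + b)" "coprime (a + b) (a + 2 * b)" "coprime b (a + b)" "coprime b (a + 2 * b)"
proof -
  show "coprime a (a + b)" using coprime_add_multiple[of a b a] assms by (simp add: add.commute)
  show b: "coprime b (a + b)" using coprime_add_multiple[of b a b] assms by (simp add: coprime_commute)
  show "coprime b (a + 2 * b)"
    using coprime_add_multiple[of b a "2 * b"] assms by (simp add: coprime_commute)
  show "coprime (a + b) (a + 2 * b)"
    using coprime_add_multiple[of "a + b" b "a + b"] b
    by (simp add: coprime_commute mult_2 add.commute add.left_commute)
qed

lemma progression_gcd:
  fixes a b k :: nat
  assumes "coprime a b" "k dvd a"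
  shows "gcd k (a + 2 * b) dvd 2"
proof -
  let ?d = "gcd k (a + 2 * b)"
  have "?d dvd a" using assms(2) by (meson dvd_trans gcd_dvd1)
  moreover from this have "?d dvd 2 * b" by (meson dvd_add_right_iff gcd_dvd2)
  moreover from \<open>?d dvd a\<close> have "coprime ?d b" using assms(1) by (meson coprime_divisors dvd_refl)
  ultimately show ?thesis by (simp add: coprime_dvd_mult_left_iff)
qed

text \<open>Typically \<open>a = u\<^sup>2\<close>, \<open>b = c * v\<^sup>2\<close> and
  \<open>k = u\<close>. The middle term \<open>a + b\<close> is coprime to the other factors, while
  \<open>k\<close> and \<open>a + 2 * b\<close> may share a factor \<open>2\<close>; hence two
  cases.\<close>

lemma square_progression_product_first:
  fixes a b k s :: nat
  assumes eq: "k * (a + b) * (a + 2 * b) = s\<^sup>2" and cop: "coprime a b" and k: "k dvd a" "k > 0"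
  obtains t c r where "a + b = t\<^sup>2" "k = c\<^sup>2" "a + 2 * b = r\<^sup>2"
    | t c r where "a + b = t\<^sup>2" "k = 2 * c\<^sup>2" "a + 2 * b = 2 * r\<^sup>2"
proof -
  have "coprime (a + b) k" using progression_coprime(1)[OF cop] k
    by (meson coprime_commute coprime_divisors dvd_refl)
  then have "coprime (a + b) (k * (a + 2 * b))" using progression_coprime(2)[OF cop] by simp
  moreover have "(a + b) * (k * (a + 2 * b)) = s\<^sup>2" using eq by (simp add: ac_simps)
  ultimately obtain t q where t: "a + b = t\<^sup>2" and q: "k * (a + 2 * b) = q\<^sup>2"
    using coprime_mult_eq_power[of "a + b" "k * (a + 2 * b)" s 2] by auto
  show ?thesis
    using square_product_gcd_dvd_prime[OF q progression_gcd[OF cop k(1)] _ k(2)] t that by (metis two_is_prime_nat)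
qed

text \<open>Since \<open>k\<close> now divides the common difference, it is coprime to both terms,
  and no factor \<open>2\<close> can be shared.\<close>

lemma square_progression_product_difference:
  fixes a b k s :: nat
  assumes eq: "k * (a + b) * (a + 2 * b) = s\<^sup>2" and cop: "coprime a b" and k: "k dvd b"
  obtains c r where "k = c\<^sup>2" "a + 2 * b = r\<^sup>2"
proof -
  have "coprime (k * (a + b)) (a + 2 * b)"
    using progression_coprime[OF cop] k by (simp, meson coprime_divisors dvd_refl)
  then obtain q r where r: "k * (a + b) = q\<^sup>2" "a + 2 * b = r\<^sup>2"
    using coprime_mult_eq_power[OF _ eq] by auto
  have "coprime k (a + b)" using progression_coprime[OF cop] k by (meson coprime_divisors dvd_refl)
  then obtain c where "k = c\<^sup>2" using coprime_mult_eq_power[OF _ r(1)] by auto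
  then show ?thesis using r that by blast
qed

text \<open>Putting \<open>u = p * w\<close> takes one \<open>p\<close> out of each factor. What
  remains is \<open>p\<close> times a square, and its quadratic factors are prime to
  \<open>p\<close>, so \<open>p\<close> divides \<open>w\<close> too. In total \<open>p ^ 4\<close>
  comes out.\<close>

lemma prime_dvd_numerator_reduction:
  fixes p c u v s :: nat
  assumes p: "prime p" and eq: "u * (u\<^sup>2 + c * p * v\<^sup>2) * (u\<^sup>2 + 2 * (c * p * v\<^sup>2)) = s\<^sup>2"
    and u: "p dvd u" and cop: "coprime p (2 * c * v)"
  obtains k t where "u = p\<^sup>2 * k"
    "k * (p ^ 3 * k\<^sup>2 + c * v\<^sup>2) * (p ^ 3 * k\<^sup>2 + 2 * (c * v\<^sup>2)) = t\<^sup>2"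
proof -
  obtain w where w: "u = p * w" using u ..
  let ?Y = "w * (p * w\<^sup>2 + c * v\<^sup>2) * (p * w\<^sup>2 + 2 * (c * v\<^sup>2))"
  have "p * (p * (p * ?Y)) = s\<^sup>2"
    unfolding eq[symmetric] w by (simp add: power2_eq_square algebra_simps)
  then obtain t1 where "p * (p * ?Y) = p * t1\<^sup>2" using prime_times_square p by metis
  then have "p * ?Y = t1\<^sup>2" using p by (auto simp: prime_gt_0_nat)
  then obtain t2 where t2: "?Y = p * t2\<^sup>2" using prime_times_square p by metis
  have "coprime p (2 * (c * v\<^sup>2))" "coprime p (c * v\<^sup>2)" using cop by simp_all
  then have "\<not> p dvd c * v\<^sup>2" "\<not> p dvd 2 * (c * v\<^sup>2)"
    using p by (meson coprime_common_divisor dvd_refl not_prime_unit)+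
  then have "\<not> p dvd p * w\<^sup>2 + c * v\<^sup>2" "\<not> p dvd p * w\<^sup>2 + 2 * (c * v\<^sup>2)"
    by (simp_all add: dvd_add_right_iff)
  moreover have "p dvd ?Y" using t2 by simp
  ultimately have "p dvd w" using p by (simp add: prime_dvd_mult_iff)
  then obtain k where k: "w = p * k" ..
  have "p * (k * (p ^ 3 * k\<^sup>2 + c * v\<^sup>2) * (p ^ 3 * k\<^sup>2 + 2 * (c * v\<^sup>2))) = p * t2\<^sup>2"
    unfolding t2[symmetric] k by (simp add: power2_eq_square power3_eq_cube algebra_simps)
  then have "k * (p ^ 3 * k\<^sup>2 + c * v\<^sup>2) * (p ^ 3 * k\<^sup>2 + 2 * (c * v\<^sup>2)) = t2\<^sup>2"
    using p by (auto simp: prime_gt_0_nat)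
  with that[of k t2] w k show ?thesis by (simp add: power2_eq_square)
qed

section \<open>The equations for \<open>c = p\<close>, \<open>c = 2 * p\<close> and
  \<open>c = p\<^sup>2\<close>\<close>

lemma cube_mod_8: "p mod 8 = 3 \<Longrightarrow> p ^ 3 mod 8 = 3" for p :: nat
  by (subst power_mod[symmetric]) simp

lemma coprime_prime_iff: "prime p \<Longrightarrow> coprime x p \<longleftrightarrow> \<not> p dvd x" for p x :: nat
  by (metis coprime_commute coprime_common_divisor dvd_refl not_prime_unit prime_imp_coprime)

text \<open>The progression starts at \<open>u\<^sup>2\<close> with difference
  \<open>p * v\<^sup>2\<close> or, after \<open>p\<close> is cancelled, at
  \<open>p ^ 3 * k\<^sup>2\<close> with difference \<open>v\<^sup>2\<close>. Each gives one equation
  excluded by the descent and one excluded modulo \<open>8\<close>.\<close>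

lemma no_square_product_prime:
  fixes p u v b s :: nat
  assumes p: "prime p" "p mod 8 = 3" and eq: "u * (u\<^sup>2 + p * v\<^sup>2) * (u\<^sup>2 + 2 * (p * v\<^sup>2)) = s\<^sup>2"
    and v: "v = b\<^sup>2" and cop: "coprime u v" and pos: "u > 0" "v > 0"
  shows False
proof (cases "p dvd u")
  case False
  then have up: "coprime u p" using p by (simp add: coprime_prime_iff)
  have copa: "coprime (u\<^sup>2) (p * v\<^sup>2)" using cop up by simp
  have dvd: "u dvd u\<^sup>2" by simp
  show False
  proof (cases rule: square_progression_product_first[OF eq copa dvd pos(1), case_names one two])
    case (one t c r)
    then have "r\<^sup>2 = c ^ 4 + 2 * p ^ 1 * b ^ 4" by (simp add: v)
    then show False
      using no_fourth_power_sum_twice_prime_power[of p 1 r c b] p cop up pos one(2) v by simp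
  next
    case (two t c r)
    have "odd b" using cop two(2) v by auto
    have "t\<^sup>2 = 4 * c ^ 4 + p * b ^ 4" using two by (simp add: v power_mult_distrib)
    then have "t\<^sup>2 mod 8 = ((if odd c then 4 else 0) + 3) mod 8"
      using add_mult_fourth_powers_mod_8[of 4 c p b] p(2) \<open>odd b\<close> by simp
    then show False using square_mod_8[of t] by (auto split: if_splits)
  qed
next
  case True
  then have vp: "coprime v p"
    using cop p by (meson coprime_commute coprime_divisors dvd_refl)
  have "odd p" using p(2) by presburger
  then have "coprime p (2 * 1 * v)" using vp by (simp add: coprime_commute)
  then obtain k t where k: "u = p\<^sup>2 * k"
    and eq': "k * (p ^ 3 * k\<^sup>2 + 1 * v\<^sup>2) * (p ^ 3 * k\<^sup>2 + 2 * (1 * v\<^sup>2)) = t\<^sup>2"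
    using prime_dvd_numerator_reduction[OF p(1) _ True, of 1 v s] eq by auto
  have kv: "coprime k v" using cop k by simp
  have copa: "coprime (p ^ 3 * k\<^sup>2) (1 * v\<^sup>2)" using kv vp by (simp add: coprime_commute)
  have dvd: "k dvd p ^ 3 * k\<^sup>2" and "k > 0" using pos k by (simp_all add: power2_eq_square)
  show False
  proof (cases rule: square_progression_product_first[OF eq' copa dvd \<open>k > 0\<close>, case_names one two])
    case (one t c r)
    then have "r\<^sup>2 = p ^ 3 * c ^ 4 + 2 * b ^ 4" by (simp add: v)
    then show False
      using mult_fourth_power_add_twice_not_square[of "p ^ 3" c b r] cube_mod_8[OF p(2)] kv one(2) v by simp
  next
    case (two t c r)
    then have "r\<^sup>2 = b ^ 4 + 2 * p ^ 3 * c ^ 4" by (simp add: v power_mult_distrib)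
    then show False
      using no_fourth_power_sum_twice_prime_power[of p 3 r b c] cube_mod_8[OF p(2)] p kv vp pos k two(2) v
      by (simp add: coprime_commute)
  qed
qed

text \<open>Four cases, according to whether \<open>p\<close> and \<open>2\<close> divide
  \<open>u\<close>. If both or neither do, the descent applies; otherwise a congruence modulo
  \<open>8\<close> suffices.\<close>

lemma no_square_product_twice_prime:
  fixes p u v b s :: nat
  assumes p: "prime p" "p mod 8 = 3"
    and eq: "u * (u\<^sup>2 + 2 * p * v\<^sup>2) * (u\<^sup>2 + 2 * (2 * p * v\<^sup>2)) = s\<^sup>2"
    and v: "v = b\<^sup>2" and cop: "coprime u v" and pos: "u > 0" "v > 0"
  shows False
proof (cases "p dvd u")
  case False
  then have up: "coprime u p" using p by (simp add: coprime_prime_iff)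
  show False
  proof (cases "even u")
    case False
    then have copa: "coprime (u\<^sup>2) (2 * p * v\<^sup>2)" using cop up by simp
    have dvd: "u dvd u\<^sup>2" by simp
    show False
    proof (cases rule: square_progression_product_first[OF eq copa dvd pos(1), case_names one two])
      case (one t c r)
      then have "t\<^sup>2 = c ^ 4 + 2 * p ^ 1 * b ^ 4" by (simp add: v)
      then show False
        using no_fourth_power_sum_twice_prime_power[of p 1 t c b] p cop up pos one(2) v by simp
    next
      case (two t c r)
      then show False using False by simp
    qed
  next
    case True
    then obtain w where w: "u = 2 * w" ..
    \<comment> \<open>Halving \<open>u\<close> makes the quadratic factors
      \<open>2 * (p * v\<^sup>2 + 2 * w\<^sup>2)\<close> and
      \<open>4 * (p * v\<^sup>2 + w\<^sup>2)\<close>: they exchange places, and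
      \<open>w\<^sup>2\<close> becomes the common difference.\<close>
    have eq4: "4\<^sup>2 * (w * (p * v\<^sup>2 + w\<^sup>2) * (p * v\<^sup>2 + 2 * w\<^sup>2)) = s\<^sup>2"
      unfolding eq[symmetric] w by (simp add: power2_eq_square algebra_simps)
    then have "4 dvd s" by (metis dvd_triv_left pow_divides_pow_iff zero_less_numeral)
    then obtain s' where "s = 4 * s'" ..
    with eq4 have eq': "w * (p * v\<^sup>2 + w\<^sup>2) * (p * v\<^sup>2 + 2 * w\<^sup>2) = s'\<^sup>2"
      by (simp add: power_mult_distrib)
    have wv: "coprime w v" using cop w by simp
    have "coprime (p * v\<^sup>2) (w\<^sup>2)" using cop up w by (simp add: coprime_commute)
    then obtain c r where c: "w = c\<^sup>2" "p * v\<^sup>2 + 2 * w\<^sup>2 = r\<^sup>2"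
      using square_progression_product_difference[OF eq'] by auto
    then have "r\<^sup>2 = p * b ^ 4 + 2 * c ^ 4" by (simp add: v)
    then show False
      using mult_fourth_power_add_twice_not_square[of p b c r] p(2) wv c(1) v
      by (simp add: coprime_commute)
  qed
next
  case True
  then have vp: "coprime v p"
    using cop p by (meson coprime_commute coprime_divisors dvd_refl)
  have "odd p" using p(2) by presburger
  then have "coprime p (2 * 2 * v)" unfolding coprime_mult_right_iff using vp by (simp add: coprime_commute)
  then obtain k t where k: "u = p\<^sup>2 * k"
    and eq': "k * (p ^ 3 * k\<^sup>2 + 2 * v\<^sup>2) * (p ^ 3 * k\<^sup>2 + 2 * (2 * v\<^sup>2)) = t\<^sup>2"
    using prime_dvd_numerator_reduction[OF p(1) eq True] by auto
  have kv: "coprime k v" using cop k by simp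
  show False
  proof (cases "even k")
    case False
    have copa: "coprime (p ^ 3 * k\<^sup>2) (2 * v\<^sup>2)"
      using kv vp False \<open>odd p\<close> by (simp add: coprime_commute)
    have dvd: "k dvd p ^ 3 * k\<^sup>2" and "k > 0" using pos k by (simp_all add: power2_eq_square)
    show False
    proof (cases rule: square_progression_product_first[OF eq' copa dvd \<open>k > 0\<close>, case_names one two])
      case (one t c r)
      then have "t\<^sup>2 = p ^ 3 * c ^ 4 + 2 * b ^ 4" by (simp add: v)
      then show False
        using mult_fourth_power_add_twice_not_square[of "p ^ 3" c b t] cube_mod_8[OF p(2)] kv one(2) v by simp
    next
      case (two t c r)
      then show False using False by simp
    qed
  next
    case True
    then obtain l where l: "k = 2 * l" ..
    \<comment> \<open>The same exchange: the progression now starts at \<open>v\<^sup>2\<close> with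
      difference \<open>p ^ 3 * l\<^sup>2\<close>.\<close>
    let ?a = "v\<^sup>2 + p ^ 3 * l\<^sup>2" and ?b = "v\<^sup>2 + 2 * (p ^ 3 * l\<^sup>2)"
    have eq4: "4\<^sup>2 * (l * ?a * ?b) = t\<^sup>2"
      unfolding eq'[symmetric] l by (simp add: power2_eq_square algebra_simps)
    then have "4 dvd t" by (metis dvd_triv_left pow_divides_pow_iff zero_less_numeral)
    then obtain t' where "t = 4 * t'" ..
    with eq4 have eq'': "l * ?a * ?b = t'\<^sup>2"
      by (simp add: power_mult_distrib)
    have lv: "coprime l v" using kv l by simp
    then have "coprime (v\<^sup>2) (p ^ 3 * l\<^sup>2)" using vp by (simp add: coprime_commute)
    then obtain c r where c: "l = c\<^sup>2" "?b = r\<^sup>2"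
      using square_progression_product_difference[OF eq''] by auto
    then have "r\<^sup>2 = b ^ 4 + 2 * p ^ 3 * c ^ 4" by (simp add: v)
    then show False
      using no_fourth_power_sum_twice_prime_power[of p 3 r b c] cube_mod_8[OF p(2)] p lv vp pos k l c(1) v
      by (simp add: coprime_commute)
  qed
qed

lemma prime_times_coprime_product_square:
  fixes p X Y s :: nat
  assumes p: "prime p" and eq: "p * (X * Y) = s\<^sup>2" and cop: "coprime X Y"
  obtains x y where "X = p * x\<^sup>2" "Y = y\<^sup>2" | x y where "X = x\<^sup>2" "Y = p * y\<^sup>2"
proof -
  obtain t where t: "X * Y = p * t\<^sup>2" using prime_times_square[OF eq p] .
  have p0: "p > 0" using p by (simp add: prime_gt_0_nat)
  have "p dvd X \<or> p dvd Y" using t p by (metis dvd_triv_left prime_dvd_mult_iff)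
  then show ?thesis
  proof
    assume "p dvd X"
    then obtain X' where X': "X = p * X'" ..
    then have "X' * Y = t\<^sup>2" "coprime X' Y" using t p0 cop by auto
    then show ?thesis using coprime_mult_eq_power[of X' Y t 2] that(1) X' by auto
  next
    assume "p dvd Y"
    then obtain Y' where Y': "Y = p * Y'" ..
    then have "X * Y' = t\<^sup>2" "coprime X Y'" using t p0 cop by auto
    then show ?thesis using coprime_mult_eq_power[of X Y' t 2] that(2) Y' by auto
  qed
qed

lemma no_square_product_prime_square:
  fixes p u v b s :: nat
  assumes p: "prime p" "p mod 8 = 3 \<or> p mod 8 = 5"
    and eq: "u * (u\<^sup>2 + p\<^sup>2 * v\<^sup>2) * (u\<^sup>2 + 2 * (p\<^sup>2 * v\<^sup>2)) = s\<^sup>2"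
    and v: "v = b\<^sup>2" and cop: "coprime u v" and pos: "u > 0" "v > 0"
  shows False
proof (cases "p dvd u")
  have "odd p" using p(2) by presburger
  case False
  then have up: "coprime u p" using p by (simp add: coprime_prime_iff)
  have copa: "coprime (u\<^sup>2) (p\<^sup>2 * v\<^sup>2)" using cop up by simp
  have dvd: "u dvd u\<^sup>2" by simp
  show False
  proof (cases rule: square_progression_product_first[OF eq copa dvd pos(1), case_names one two])
    case (one t c r)
    then show False
      using no_three_squares_difference_square[of u "p * v" t r] cop up pos p
      by (simp add: power_mult_distrib prime_gt_0_nat)
  next
    case (two t c r)
    have "odd v" using cop two(2) by auto
    \<comment> \<open>Halving \<open>a + 2 * b = 2 * r\<^sup>2\<close> reverses the order:
      \<open>(p * v)\<^sup>2\<close>, \<open>r\<^sup>2\<close>, \<open>t\<^sup>2\<close> form a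
      progression with difference \<open>2 * (c\<^sup>2)\<^sup>2\<close>.\<close>
    have "(p * v)\<^sup>2 + 2 * (c\<^sup>2)\<^sup>2 = r\<^sup>2" "(p * v)\<^sup>2 + 4 * (c\<^sup>2)\<^sup>2 = t\<^sup>2"
      using two by (simp_all add: power_mult_distrib)
    moreover have "coprime (p * v) (c\<^sup>2)" using cop up two(2) by (simp add: coprime_commute)
    ultimately show False
      using no_three_squares_difference_twice_square[of "p * v" "c\<^sup>2" r t] \<open>odd v\<close> \<open>odd p\<close> pos two(2)
      by simp
  qed
next
  case True
  then have vp: "coprime v p"
    using cop p by (meson coprime_commute coprime_divisors dvd_refl)
  have p0: "p > 0" using p by (simp add: prime_gt_0_nat)
  obtain w where w: "u = p * w" using True ..
  have wv: "coprime w v" and w0: "w > 0" using cop pos w by auto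
  then have wv2: "coprime (w\<^sup>2) (v\<^sup>2)" by simp
  let ?B = "w\<^sup>2 + v\<^sup>2" and ?C = "w\<^sup>2 + 2 * v\<^sup>2"
  \<comment> \<open>One \<open>p\<close> comes from \<open>u\<close> and \<open>p\<^sup>2\<close>
    from each quadratic factor; of \<open>p ^ 5\<close> the part that is not a square stays.\<close>
  have "(p\<^sup>2)\<^sup>2 * (p * ((w * ?C) * ?B)) = s\<^sup>2"
    unfolding eq[symmetric] w by (simp add: power2_eq_square algebra_simps)
  moreover from this have "p\<^sup>2 dvd s" by (metis dvd_triv_left pow_divides_pow_iff zero_less_numeral)
  then obtain s' where "s = p\<^sup>2 * s'" ..
  ultimately have eq': "p * ((w * ?C) * ?B) = s'\<^sup>2" using p0 by (simp add: power_mult_distrib)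
  have gcd: "gcd w ?C dvd 2" using progression_gcd[OF wv2] by simp
  have copB: "coprime (w * ?C) ?B"
    using progression_coprime[OF wv2] by (simp add: coprime_commute)
  have nb: "\<not> (even w \<and> even v)" using wv by (auto dest: coprime_common_divisor)
  show False
  proof (cases rule: prime_times_coprime_product_square[OF p(1) eq' copB, case_names C B])
    case (B x y)
    show False
    proof (cases rule: square_product_gcd_dvd_prime[OF B(1) gcd two_is_prime_nat w0, case_names one two])
      case (one c r)
      have "p * y\<^sup>2 = c ^ 4 + b ^ 4" using B one by (simp add: v)
      then have "(p * y\<^sup>2) mod 8 = ((if odd c then 1 else 0) + (if odd b then 1 else 0)) mod 8"
        using add_mult_fourth_powers_mod_8[of 1 c 1 b] by simp
      moreover have "(p * y\<^sup>2) mod 8 = (p mod 8 * (y\<^sup>2 mod 8)) mod 8" by (simp add: mod_mult_eq)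
      moreover have "odd c \<or> odd b" using nb one v by auto
      ultimately show False using p(2) square_mod_8[of y]
        by (elim disjE; cases "odd c"; cases "odd b") simp_all
    next
      case (two c r)
      have "odd b" using nb two(1) v by auto
      have "r\<^sup>2 = 2 * c ^ 4 + b ^ 4" using two by (simp add: v power_mult_distrib)
      then have "r\<^sup>2 mod 8 = ((if odd c then 2 else 0) + 1) mod 8"
        using add_mult_fourth_powers_mod_8[of 2 c 1 b] \<open>odd b\<close> by simp
      \<comment> \<open>An odd \<open>c\<close> would make \<open>r\<^sup>2\<close> equal to
        \<open>3\<close> modulo \<open>8\<close>. This parity matters: for odd \<open>c\<close>,
        \<open>4 * c ^ 4 + b ^ 4\<close> would be \<open>5\<close>, a possible residue of
        \<open>p * y\<^sup>2\<close>.\<close>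
      then have "even c" using square_mod_8[of r] by (auto split: if_splits)
      have "p * y\<^sup>2 = 4 * c ^ 4 + b ^ 4" using B two by (simp add: v power_mult_distrib)
      then have "(p * y\<^sup>2) mod 8 = 1"
        using add_mult_fourth_powers_mod_8[of 4 c 1 b] \<open>odd b\<close> \<open>even c\<close> by simp
      moreover have "(p * y\<^sup>2) mod 8 = (p mod 8 * (y\<^sup>2 mod 8)) mod 8" by (simp add: mod_mult_eq)
      ultimately show False using p(2) square_mod_8[of y] by (elim disjE) simp_all
    qed
  next
    case (C x y)
    \<comment> \<open>If \<open>p\<close> divides \<open>w\<close>, three squares in progression
      reappear; if it divides \<open>?C\<close>, then \<open>?B = y\<^sup>2\<close> is itself the
      descent equation with \<open>G = 1\<close> or \<open>G = 4\<close>.\<close>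
    have "p dvd w \<or> p dvd ?C" using C(1) p(1) by (metis dvd_triv_left prime_dvd_mult_iff)
    then show False
    proof
      assume "p dvd w"
      then obtain w' where w': "w = p * w'" ..
      have sq: "w' * ?C = x\<^sup>2" using C(1) p0 by (simp add: w' mult.assoc)
      have "w' dvd w" by (simp add: w')
      then have gcd': "gcd w' ?C dvd 2" by (rule dvd_trans[OF gcd_mono[OF _ dvd_refl] gcd])
      have "w' > 0" using w0 w' by simp
      show False
      proof (cases rule: square_product_gcd_dvd_prime
          [OF sq gcd' two_is_prime_nat \<open>w' > 0\<close>, case_names one two])
        case (one c r)
        then show False using no_three_squares_difference_square[of w v y r] C wv pos by simp
      next
        case (two c r)
        have "odd v" using nb two(1) w' by auto
        have "v\<^sup>2 + 2 * (p * c\<^sup>2)\<^sup>2 = r\<^sup>2" "v\<^sup>2 + 4 * (p * c\<^sup>2)\<^sup>2 = y\<^sup>2"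
          using two C by (simp_all add: w' power_mult_distrib)
        moreover have "coprime v (p * c\<^sup>2)" using wv vp two(1) w' by (simp add: coprime_commute)
        moreover have "p * c\<^sup>2 > 0" using two(1) p0 \<open>w' > 0\<close> by simp
        ultimately show False
          using no_three_squares_difference_twice_square[of v "p * c\<^sup>2" r y] \<open>odd v\<close> by blast
      qed
    next
      assume "p dvd ?C"
      then obtain C' where C': "?C = p * C'" ..
      have sq: "w * C' = x\<^sup>2" using C(1) p0 by (simp add: C')
      have "C' dvd ?C" by (simp add: C')
      then have gcd': "gcd w C' dvd 2" by (rule dvd_trans[OF gcd_mono[OF dvd_refl] gcd])
      show False
      proof (cases rule: square_product_gcd_dvd_prime[OF sq gcd' two_is_prime_nat w0, case_names one two])
        case (one c r)
        have "y\<^sup>2 = c ^ 4 + 1 * b ^ 4" using C one by (simp add: v)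
        moreover have "descent_coefficient 1" by (simp add: descent_coefficient_def)
        ultimately show False using no_fourth_power_sum[of 1 y c b] wv one(1) v pos w0 by simp
      next
        case (two c r)
        have "odd b" using nb two(1) v by auto
        have "y\<^sup>2 = b ^ 4 + 4 * c ^ 4" using C two by (simp add: v power_mult_distrib)
        moreover have "descent_coefficient 4" by (simp add: descent_coefficient_def)
        moreover have "coprime b (2 * 2 * c)"
          unfolding coprime_mult_right_iff using wv two(1) v \<open>odd b\<close> by (simp add: coprime_commute)
        ultimately show False using no_fourth_power_sum[of 4 y b c] two(1) v pos w0 by simp
      qed
    qed
  qed
qed

section \<open>From rational points to coprime integers\<close>

lemma square_of_rat_imp_square:
  fixes K :: nat and q :: rat
  assumes "of_nat K = q\<^sup>2"
  obtains s where "K = s\<^sup>2"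
proof -
  obtain a d where ad: "quotient_of q = (a, d)" by (cases "quotient_of q")
  then have d: "d > 0" "coprime a d" and q: "q = of_int a / of_int d"
    by (simp_all add: quotient_of_denom_pos quotient_of_coprime quotient_of_div)
  have "of_int (int K * d\<^sup>2) = (of_int (a\<^sup>2) :: rat)"
    using assms d by (simp add: q field_simps)
  then have eq: "int K * d\<^sup>2 = a\<^sup>2" by (simp only: of_int_eq_iff)
  have "d\<^sup>2 dvd a\<^sup>2" unfolding eq[symmetric] by simp
  moreover have "coprime (a\<^sup>2) (d\<^sup>2)" using d by simp
  ultimately have "is_unit (d\<^sup>2)" by (meson coprime_common_divisor dvd_refl)
  then have "d = 1" using d(1) by (simp add: power2_eq_1_iff)
  with eq have "int K = int ((nat \<bar>a\<bar>)\<^sup>2)" by simp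
  then have "K = (nat \<bar>a\<bar>)\<^sup>2" by (simp only: of_nat_eq_iff)
  then show ?thesis using that by blast
qed

text \<open>Both quadratic factors are positive, so \<open>x = u / v > 0\<close>. Multiplying by the
  even power \<open>v ^ 6\<close> clears denominators and leaves one extra \<open>v\<close>, coprime
  to the remaining product; hence both are squares.\<close>

lemma nonzero_rational_point_imp_square_product:
  fixes x y :: rat and c :: nat
  assumes eq: "y\<^sup>2 = x * (x\<^sup>2 + of_nat c) * (x\<^sup>2 + 2 * of_nat c)" and c: "c > 0" and x: "x \<noteq> 0"
  obtains u v b s :: nat where "u > 0" "v > 0" "coprime u v" "v = b\<^sup>2"
    "u * (u\<^sup>2 + c * v\<^sup>2) * (u\<^sup>2 + 2 * (c * v\<^sup>2)) = s\<^sup>2"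
proof -
  have "x > 0"
  proof (rule ccontr)
    assume "\<not> x > 0"
    then have "x < 0" using x by simp
    moreover have "x\<^sup>2 + of_nat c > 0" "x\<^sup>2 + 2 * of_nat c > 0"
      using c by (simp_all add: add_nonneg_pos)
    ultimately have "x * (x\<^sup>2 + of_nat c) * (x\<^sup>2 + 2 * of_nat c) < 0"
      by (simp add: mult_neg_pos)
    then show False using eq by (metis not_less zero_le_power2)
  qed
  obtain a d where ad: "quotient_of x = (a, d)" by (cases "quotient_of x")
  then have d: "d > 0" "coprime a d" and xq: "x = of_int a / of_int d"
    by (simp_all add: quotient_of_denom_pos quotient_of_coprime quotient_of_div)
  have a: "a > 0" using \<open>x > 0\<close> d by (simp add: xq zero_less_divide_iff)
  define u v where "u = nat a" and "v = nat d"
  have uv: "u > 0" "v > 0" using a d by (simp_all add: u_def v_def)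
  have au: "a = int u" and dv: "d = int v" using a d by (simp_all add: u_def v_def)
  have cop: "coprime u v" using d(2) by (simp add: au dv)
  have xuv: "x = of_nat u / of_nat v" using xq by (simp add: au dv)
  define U V where "U = (of_nat u :: rat)" and "V = (of_nat v :: rat)"
  have V0: "V \<noteq> 0" using uv by (simp add: V_def)
  let ?M = "u * (u\<^sup>2 + c * v\<^sup>2) * (u\<^sup>2 + 2 * (c * v\<^sup>2))"
  have "(y * V ^ 3)\<^sup>2 = (V * x) * V * (V\<^sup>2 * (x\<^sup>2 + of_nat c)) * (V\<^sup>2 * (x\<^sup>2 + 2 * of_nat c))"
    unfolding power_mult_distrib eq by (simp add: power2_eq_square power3_eq_cube)
  also have "\<dots> = U * V * (U\<^sup>2 + of_nat c * V\<^sup>2) * (U\<^sup>2 + 2 * (of_nat c * V\<^sup>2))"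
    using V0 unfolding xuv U_def[symmetric] V_def[symmetric]
    by (simp add: power_divide field_simps)
  also have "\<dots> = of_nat (v * ?M)" by (simp add: U_def V_def)
  finally obtain s where s: "v * ?M = s\<^sup>2" using square_of_rat_imp_square by metis
  have "coprime v ?M" using cop coprime_add_multiple[of v "u\<^sup>2" "c * v\<^sup>2"]
      coprime_add_multiple[of v "u\<^sup>2" "2 * (c * v\<^sup>2)"] by (simp add: coprime_commute)
  then obtain b t where "v = b\<^sup>2" "?M = t\<^sup>2" using coprime_mult_eq_power[OF _ s] by auto
  then show ?thesis using that uv cop by blast
qed

lemma C_rational_points_eq:
  assumes c: "c = 2 powi i * of_nat p powi j"
    and none: "\<And>x y :: rat. y\<^sup>2 = x * (x\<^sup>2 + c) * (x\<^sup>2 + 2 * c) \<Longrightarrow> x = 0"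
  shows "C_rational_points p i j = {Affine 0 0, Infinity}"
proof -
  have c2: "2 powi (i + 1) * of_nat p powi j = 2 * c" by (simp add: c power_int_add)
  have "poly (C_poly p i j) x = x * (x\<^sup>2 + c) * (x\<^sup>2 + 2 * c)" for x
    by (simp only: poly_C_poly c2 c[symmetric])
  then have "y\<^sup>2 = poly (C_poly p i j) x \<longleftrightarrow> x = 0 \<and> y = 0" for x y
    using none[of y x] by auto
  then show ?thesis unfolding C_rational_points_def hyperelliptic_points_def by auto
qed

theorem theorem1p1:
  fixes p :: nat and i j :: int
  assumes "prime p"
    and "[int p = 3] (mod 16) \<and> (i, j) = (0, 1)
       \<or> [int p = 11] (mod 16) \<and> (i, j) = (1, 1)
       \<or> [int p = 3] (mod 8) \<and> (i, j) = (0, 2)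
       \<or> [int p = - 3] (mod 8) \<and> (i, j) = (0, 2)"
  shows "C_rational_points p i j = {Affine 0 0, Infinity}"
proof -
  have p0: "p > 0" using assms(1) by (simp add: prime_gt_0_nat)
  \<comment> \<open>The conditions are sorted by the value of \<open>c\<close>. Both
    \<open>3\<close> and \<open>11\<close> modulo \<open>16\<close> reduce to \<open>3\<close>
    modulo \<open>8\<close>, and \<open>- 3\<close> reduces to \<open>5\<close>.\<close>
  consider "p mod 8 = 3" "i = 0" "j = 1" | "p mod 8 = 3" "i = 1" "j = 1"
    | "p mod 8 = 3 \<or> p mod 8 = 5" "i = 0" "j = 2"
  proof -
    have mod3: "p mod 8 = 3" if "[int p = 3] (mod 8)"
    proof -
      have "int (p mod 8) = int 3" using that by (simp add: cong_def zmod_int)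
      then show ?thesis by (simp only: of_nat_eq_iff)
    qed
    moreover have "p mod 8 = 3" if "[int p = 3] (mod 16)"
      using cong_dvd_modulus[OF that, of 8] mod3 by simp
    moreover have "p mod 8 = 3" if "[int p = 11] (mod 16)"
      using cong_dvd_modulus[OF that, of 8] mod3 by (simp add: cong_def)
    moreover have "p mod 8 = 5" if "[int p = - 3] (mod 8)"
    proof -
      have "int (p mod 8) = int 5" using that by (simp add: cong_def zmod_int)
      then show ?thesis by (simp only: of_nat_eq_iff)
    qed
    ultimately show ?thesis using assms(2) that by auto
  qed
  then show ?thesis
  proof cases
    case 1
    have "x = 0" if "y\<^sup>2 = x * (x\<^sup>2 + of_nat p) * (x\<^sup>2 + 2 * of_nat p)" for x y :: rat
      using nonzero_rational_point_imp_square_product[OF that p0]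
        no_square_product_prime[OF assms(1) 1(1)] by metis
    then show ?thesis by (intro C_rational_points_eq[of "of_nat p"]) (use 1 in auto)
  next
    case 2
    have "x = 0" if "y\<^sup>2 = x * (x\<^sup>2 + of_nat (2 * p)) * (x\<^sup>2 + 2 * of_nat (2 * p))" for x y :: rat
      using nonzero_rational_point_imp_square_product[OF that] p0
        no_square_product_twice_prime[OF assms(1) 2(1)] by (metis mult_pos_pos zero_less_numeral)
    then show ?thesis by (intro C_rational_points_eq[of "of_nat (2 * p)"]) (use 2 in auto)
  next
    case 3
    have "x = 0" if "y\<^sup>2 = x * (x\<^sup>2 + of_nat (p\<^sup>2)) * (x\<^sup>2 + 2 * of_nat (p\<^sup>2))" for x y :: rat
      using nonzero_rational_point_imp_square_product[OF that] p0
        no_square_product_prime_square[OF assms(1) 3(1)] by (metis zero_less_power)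
    then show ?thesis by (intro C_rational_points_eq[of "of_nat (p\<^sup>2)"]) (use 3 in auto)
  qed
qed

end
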